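(* Let $n\ge 1$ and let $\mathcal{A}=\langle Q,\Sigma\rangle$ be a synchronizing complete deterministic finite automaton with $|Q|=n$ states and $|\Sigma|=2$ input letters such that both letters act on $Q$ as idempotent selfmaps. Then the reset threshold of $\mathcal{A}$ does not exceed $n-1$.
   Context: A complete deterministic finite automaton (DFA) $\langle Q,\Sigma\rangle$ consists of a finite state set $Q$, a finite input alphabet $\Sigma$, and a totally defined transition function $Q\times\Sigma\to Q$, written $(q,a)\mapsto q.a$. It extends to words $w\in\Sigma^*$ (finite words, including the empty word) by $q.w:=q$ if $w$ is empty and $q.(va):=(q.v).a$ for $v\in\Sigma^*$, $a\in\Sigma$. A word $w\in\Sigma^*$ is a reset word for the DFA if $q.w=q'.w$ for all $q,q'\in Q$. The DFA is synchronizing if it has a reset word; its reset threshold is then the minimum length of its reset words. A letter $a\in\Sigma$ acts as an idempotent selfmap if $(q.a).a=q.a$ for every $q\in Q$. *)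

theory Defs
  imports Main
begin

locale complete_dfa =
  fixes Q :: "'q set" and \<Sigma> :: "'a set" and \<delta> :: "'q \<Rightarrow> 'a \<Rightarrow> 'q"
  assumes finite_states: "finite Q"
    and finite_alphabet: "finite \<Sigma>"
    and step_closed: "q \<in> Q \<Longrightarrow> a \<in> \<Sigma> \<Longrightarrow> \<delta> q a \<in> Q"

(* foldl reads the word from left to right: q.(va) = (q.v).a *)
definition run :: "('q \<Rightarrow> 'a \<Rightarrow> 'q) \<Rightarrow> 'q \<Rightarrow> 'a list \<Rightarrow> 'q" where
  "run \<delta> q w = foldl \<delta> q w"

definition reset_word :: "'q set \<Rightarrow> 'a set \<Rightarrow> ('q \<Rightarrow> 'a \<Rightarrow> 'q) \<Rightarrow> 'a list \<Rightarrow> bool" where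
  "reset_word Q \<Sigma> \<delta> w \<longleftrightarrow>
     w \<in> lists \<Sigma> \<and> (\<forall>q\<in>Q. \<forall>q'\<in>Q. run \<delta> q w = run \<delta> q' w)"

definition synchronizing :: "'q set \<Rightarrow> 'a set \<Rightarrow> ('q \<Rightarrow> 'a \<Rightarrow> 'q) \<Rightarrow> bool" where
  "synchronizing Q \<Sigma> \<delta> \<longleftrightarrow> (\<exists>w. reset_word Q \<Sigma> \<delta> w)"

(* meaningful only for synchronizing automata; otherwise LEAST is unspecified *)
definition reset_threshold :: "'q set \<Rightarrow> 'a set \<Rightarrow> ('q \<Rightarrow> 'a \<Rightarrow> 'q) \<Rightarrow> nat" where
  "reset_threshold Q \<Sigma> \<delta> = (LEAST k. \<exists>w. reset_word Q \<Sigma> \<delta> w \<and> length w = k)"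

definition idempotent_letter :: "'q set \<Rightarrow> ('q \<Rightarrow> 'a \<Rightarrow> 'q) \<Rightarrow> 'a \<Rightarrow> bool" where
  "idempotent_letter Q \<delta> a \<longleftrightarrow> (\<forall>q\<in>Q. \<delta> (\<delta> q a) a = \<delta> q a)"

end

theory Submission
  imports Defs
begin

text \<open>
  Write \<open>X.c\<close> for the image of a set \<open>X\<close> of states under a letter \<open>c\<close>. If \<open>X.c.d = X\<close>, then, the
  letters being idempotent, every word maps \<open>X\<close> onto \<open>X\<close> or \<open>X.c\<close>, two sets of equal size; so
  \<open>X\<close> is a singleton by synchronizability. Along an alternating word the images \<open>X\<^sub>k\<close>
  therefore satisfy \<open>X\<^sub>k\<^sub>+\<^sub>2 \<subset> X\<^sub>k\<close> until a singleton occurs, and \<open>|X\<^sub>k| + |X\<^sub>k\<^sub>+\<^sub>1|\<close> drops at each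
  step. The alternating word of length \<open>n - 1\<close> starting with \<open>a\<close> is thus a reset word if
  \<open>|Q.a| + |Q.a.b| \<le> n\<close>. A state in \<open>Q.a \<inter> Q.b\<close> is fixed by both letters, so there is at most one;
  hence if this inequality fails for both orders of the letters, then \<open>Q = Q.a \<union> Q.b\<close>,
  \<open>Q.a.b = Q.b\<close> and \<open>Q.b.a = Q.a\<close>, which forces \<open>n = 1\<close>.
\<close>

lemma run_Nil [simp]: "run \<delta> q [] = q"
  by (simp add: run_def)

lemma run_Cons [simp]: "run \<delta> q (c # w) = run \<delta> (\<delta> q c) w"
  by (simp add: run_def)

lemma run_image_Cons: "(\<lambda>q. run \<delta> q (c # w)) ` X = (\<lambda>q. run \<delta> q w) ` ((\<lambda>q. \<delta> q c) ` X)"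
  by (simp add: image_image)

lemma card_image_singleton: "card X = 1 \<Longrightarrow> card (f ` X) = 1"
  by (auto simp: card_1_singleton_iff)

locale sync_idempotent_dfa = complete_dfa Q \<Sigma> \<delta>
  for Q :: "'q set" and \<Sigma> :: "'a set" and \<delta> :: "'q \<Rightarrow> 'a \<Rightarrow> 'q" +
  assumes sync: "synchronizing Q \<Sigma> \<delta>"
    and idempotent: "c \<in> \<Sigma> \<Longrightarrow> idempotent_letter Q \<delta> c"
begin

abbreviation act :: "'q set \<Rightarrow> 'a \<Rightarrow> 'q set" where
  "act X c \<equiv> (\<lambda>q. \<delta> q c) ` X"

lemma act_subset: "X \<subseteq> Q \<Longrightarrow> c \<in> \<Sigma> \<Longrightarrow> act X c \<subseteq> Q"
  using step_closed by blast

lemma step_idem: "q \<in> Q \<Longrightarrow> c \<in> \<Sigma> \<Longrightarrow> \<delta> (\<delta> q c) c = \<delta> q c"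
  using idempotent unfolding idempotent_letter_def by blast

lemma act_idem: "X \<subseteq> Q \<Longrightarrow> c \<in> \<Sigma> \<Longrightarrow> act (act X c) c = act X c"
  using step_idem by (force simp: image_image)

text \<open>Every word fixes both states, while some reset word merges them.\<close>

lemma fixed_by_all_unique:
  assumes "x \<in> Q" "y \<in> Q" "\<forall>c\<in>\<Sigma>. \<delta> x c = x" "\<forall>c\<in>\<Sigma>. \<delta> y c = y"
  shows "x = y"
proof -
  have fixed: "run \<delta> z w = z" if "\<forall>c\<in>\<Sigma>. \<delta> z c = z" "w \<in> lists \<Sigma>" for z w
    using that(2,1) by (induction w) auto
  obtain w where "reset_word Q \<Sigma> \<delta> w"
    using sync unfolding synchronizing_def by blast
  then show ?thesis
    using assms fixed unfolding reset_word_def by metis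
qed

lemma card_recurrent_set:
  assumes \<Sigma>: "\<Sigma> = {c, d}" and X: "X \<subseteq> Q" "X \<noteq> {}" and rec: "act (act X c) d = X"
  shows "card X = 1"
proof -
  let ?Y = "act X c"
  have fin: "finite X" using X finite_states finite_subset by blast
  have card_Y: "card ?Y = card X"
    using fin rec card_image_le[of X "\<lambda>q. \<delta> q c"] card_image_le[of ?Y "\<lambda>q. \<delta> q d"] by simp
  have Y: "?Y \<subseteq> Q" using act_subset X \<Sigma> by simp
  have mem: "c \<in> \<Sigma>" "d \<in> \<Sigma>" using \<Sigma> by simp_all
  \<comment> \<open>By \<open>rec\<close>, \<open>X\<close> is itself an image under
    \<open>d\<close>, just as \<open>?Y\<close> is one under \<open>c\<close>; idempotence makes
    each letter preserve its own image.\<close>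
  have steps: "act X d = X" "act ?Y c = ?Y"
    using act_idem[OF Y mem(2)] act_idem[OF X(1) mem(1)] unfolding rec .
  have swap: "(\<lambda>q. run \<delta> q w) ` Z \<in> {X, ?Y}" if "w \<in> lists \<Sigma>" "Z \<in> {X, ?Y}" for w Z
    using that
  proof (induction w arbitrary: Z)
    case Nil
    then show ?case by simp
  next
    case (Cons e w)
    then have "e = c \<or> e = d" "Z = X \<or> Z = ?Y" using \<Sigma> by simp_all
    then have "act Z e \<in> {X, ?Y}"
      using steps rec by (elim disjE) simp_all
    with Cons.IH Cons.prems(1) show ?case
      unfolding run_image_Cons by simp
  qed
  obtain w where w: "w \<in> lists \<Sigma>" "\<forall>q\<in>Q. \<forall>q'\<in>Q. run \<delta> q w = run \<delta> q' w"
    using sync unfolding synchronizing_def reset_word_def by blast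
  obtain x where "x \<in> X" using X by blast
  then have "(\<lambda>q. run \<delta> q w) ` X = {run \<delta> x w}"
    using w X by blast
  then have "card ((\<lambda>q. run \<delta> q w) ` X) = 1" by simp
  then show ?thesis
    using swap[OF w(1), of X] card_Y by (metis insertE insertI1 singletonD)
qed

text \<open>The inclusion passes from \<open>X\<close> to \<open>act X c\<close> with the letters
  exchanged, so the induction alternates them. The length \<open>m\<close> is exact, and the offset
  2 is the value of the sum for two singletons.\<close>

lemma alternating_word_collapses:
  assumes "\<Sigma> = {c, d}" "X \<subseteq> Q" "X \<noteq> {}" "act (act X c) d \<subseteq> X"
    and "card X + card (act X c) \<le> m + 2"
  shows "\<exists>w\<in>lists \<Sigma>. length w = m \<and> card ((\<lambda>q. run \<delta> q w) ` X) = 1"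
  using assms
proof (induction m arbitrary: X c d)
  case 0
  have fin: "finite X" using 0(2) finite_states finite_subset by blast
  then have "card X > 0" "card (act X c) > 0"
    using 0 by (simp_all add: card_gt_0_iff)
  then have "card X = 1" using 0 by linarith
  then show ?case by (intro bexI[of _ "[]"]) auto
next
  case (Suc m)
  have fin: "finite X" using Suc.prems(2) finite_states finite_subset by blast
  show ?case
  proof (cases "act (act X c) d = X")
    case True
    then have "card X = 1" using card_recurrent_set Suc.prems(1-3) by blast
    \<comment> \<open>\<open>X\<close> is already a singleton; any word serves as padding to the
      required length.\<close>
    then have "card ((\<lambda>q. run \<delta> q (replicate (Suc m) c)) ` X) = 1"
      by (rule card_image_singleton)
    moreover have "replicate (Suc m) c \<in> lists \<Sigma>"
      using Suc.prems(1) by (simp add: in_lists_conv_set)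
    ultimately show ?thesis
      by (metis length_replicate)
  next
    case False
    then have "card (act (act X c) d) < card X"
      using Suc.prems(4) fin by (simp add: psubset_card_mono psubset_eq)
    moreover have "act (act (act X c) d) c \<subseteq> act X c"
      using Suc.prems(4) by blast
    moreover have "act X c \<subseteq> Q" "act X c \<noteq> {}" "\<Sigma> = {d, c}"
      using act_subset Suc.prems by auto
    ultimately obtain w where "w \<in> lists \<Sigma>" "length w = m"
      "card ((\<lambda>q. run \<delta> q w) ` act X c) = 1"
      using Suc.IH[of d c "act X c"] Suc.prems(5) by auto
    moreover from this have "c # w \<in> lists \<Sigma>" using Suc.prems(1) by simp
    ultimately show ?thesis
      by (metis length_Cons run_image_Cons)
  qed
qed

text \<open>The letter \<open>c\<close> is spent first: starting the descent at
  \<open>act Q c\<close> instead of \<open>Q\<close> makes the sum at most \<open>m + 2\<close>, so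
  \<open>m\<close> further letters suffice.\<close>

lemma reset_word_if_small_images:
  assumes \<Sigma>: "\<Sigma> = {c, d}" and n: "card Q = m + 2"
    and le: "card (act Q c) + card (act (act Q c) d) \<le> card Q"
  shows "\<exists>w. reset_word Q \<Sigma> \<delta> w \<and> length w = m + 1"
proof -
  have "Q \<noteq> {}" using n by auto
  moreover have "act Q c \<subseteq> Q" using act_subset \<Sigma> by simp
  moreover have "act (act (act Q c) d) c \<subseteq> act Q c"
    using act_subset[of "act Q c" d] act_subset[of Q c] \<Sigma> by blast
  ultimately obtain w where w: "w \<in> lists \<Sigma>" "length w = m"
    "card ((\<lambda>q. run \<delta> q w) ` act Q c) = 1"
    using alternating_word_collapses[of d c "act Q c" m] \<Sigma> le n by auto
  obtain z where "(\<lambda>q. run \<delta> q w) ` act Q c = {z}"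
    using w(3) by (auto simp: card_1_singleton_iff)
  then have "\<forall>q\<in>Q. run \<delta> q (c # w) = z" by auto
  then have "reset_word Q \<Sigma> \<delta> (c # w)"
    using w \<Sigma> unfolding reset_word_def by auto
  then show ?thesis using w by (intro exI[of _ "c # w"]) simp
qed

lemma large_images:
  assumes \<Sigma>: "\<Sigma> = {c, d}"
    and gt: "card (act Q c) + card (act (act Q c) d) > card Q"
  shows "act Q c \<union> act Q d = Q" and "act (act Q c) d = act Q d"
proof -
  let ?X = "act Q c" and ?Y = "act (act Q c) d"
  have sub: "?X \<subseteq> Q" "act Q d \<subseteq> Q"
    using act_subset \<Sigma> by auto
  then have sub_d: "?Y \<subseteq> act Q d" by blast
  have fin: "finite ?X" "finite ?Y" using finite_states by auto
  have fixed_image: "\<delta> x e = x" if e: "e \<in> \<Sigma>" and x: "x \<in> act Q e" for x e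
  proof -
    obtain q where "q \<in> Q" "x = \<delta> q e" using x by (rule imageE)
    then show ?thesis using step_idem e by simp
  qed
  have fixed: "\<delta> x c = x" "\<delta> x d = x" if "x \<in> ?X" "x \<in> act Q d" for x
    by (rule fixed_image; use that \<Sigma> in blast)+
  have "x = y" if "x \<in> ?X \<inter> ?Y" "y \<in> ?X \<inter> ?Y" for x y
  proof (rule fixed_by_all_unique)
    show "x \<in> Q" "y \<in> Q" using that sub by blast+
    show "\<forall>c\<in>\<Sigma>. \<delta> x c = x" "\<forall>c\<in>\<Sigma>. \<delta> y c = y"
      using that sub_d fixed[of x] fixed[of y] \<Sigma> by blast+
  qed
  \<comment> \<open>By inclusion-exclusion, an overlap of at most one state and a sum above
    \<open>card Q\<close> leave no state outside the union.\<close>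
  then have "card (?X \<inter> ?Y) \<le> 1"
    unfolding One_nat_def using card_le_Suc0_iff_eq[of "?X \<inter> ?Y"] fin(1) by blast
  then have "card (?X \<union> ?Y) \<ge> card Q"
    using card_Un_Int[OF fin] gt by linarith
  then have Un: "?X \<union> ?Y = Q"
    using sub sub_d finite_states by (intro card_seteq) auto
  then show "act Q c \<union> act Q d = Q" using sub sub_d by blast
  \<comment> \<open>A state of \<open>act Q d\<close> lying in \<open>?X\<close> is fixed by
    \<open>d\<close>, hence is its own image in \<open>?Y\<close>; one outside \<open>?X\<close> is
    in \<open>?Y\<close> because the two sets cover \<open>Q\<close>.\<close>
  have "act Q d \<subseteq> ?Y"
  proof
    fix y assume y: "y \<in> act Q d"
    show "y \<in> ?Y"
    proof (cases "y \<in> ?X")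
      case True
      then show ?thesis using fixed y by (metis imageI)
    next
      case False
      then show ?thesis using Un y sub by blast
    qed
  qed
  then show "?Y = act Q d" using sub_d by blast
qed

lemma small_images_exist:
  assumes \<Sigma>: "\<Sigma> = {a, b}" and n: "card Q \<ge> 2"
  shows "card (act Q a) + card (act (act Q a) b) \<le> card Q \<or>
         card (act Q b) + card (act (act Q b) a) \<le> card Q"
proof (rule ccontr)
  assume "\<not> ?thesis"
  then have gt: "card (act Q a) + card (act (act Q a) b) > card Q"
    "card (act Q b) + card (act (act Q b) a) > card Q" by auto
  have \<Sigma>': "\<Sigma> = {b, a}" using \<Sigma> by auto
  note ab = large_images[OF \<Sigma> gt(1)] and ba = large_images[OF \<Sigma>' gt(2)]
  have "Q \<noteq> {}" using n by auto
  \<comment> \<open>Each image is sent to the other by the other letter, so both are recurrent.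
    Their sizes then add up to only 2, which cannot exceed \<open>card Q\<close>.\<close>
  then have "card (act Q a) = 1" "card (act Q b) = 1"
    using card_recurrent_set[OF \<Sigma>', of "act Q a"] card_recurrent_set[OF \<Sigma>, of "act Q b"]
      ab ba act_subset \<Sigma> by auto
  then show False using gt(1) ab(2) n by simp
qed

end

theorem proposition5:
  fixes Q :: "'q set" and \<Sigma> :: "'a set" and \<delta> :: "'q \<Rightarrow> 'a \<Rightarrow> 'q" and n :: nat
  assumes "n \<ge> 1"
    and "complete_dfa Q \<Sigma> \<delta>"
    and "card Q = n"
    and "card \<Sigma> = 2"
    and "synchronizing Q \<Sigma> \<delta>"
    and "\<forall>a\<in>\<Sigma>. idempotent_letter Q \<delta> a"
  shows "reset_threshold Q \<Sigma> \<delta> \<le> n - 1"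
proof -
  interpret sync_idempotent_dfa Q \<Sigma> \<delta>
    using assms by (simp add: sync_idempotent_dfa_def sync_idempotent_dfa_axioms_def)
  have "\<exists>w. reset_word Q \<Sigma> \<delta> w \<and> length w = n - 1"
  proof (cases "n = 1")
    case True
    then obtain z where "Q = {z}"
      using assms(3) by (auto simp: card_1_singleton_iff)
    then show ?thesis
      using True unfolding reset_word_def by (intro exI[of _ "[]"]) auto
  next
    case False
    \<comment> \<open>The subtraction is not truncated, since \<open>n\<close> is at least 2 in this
      case.\<close>
    define m where "m = n - 2"
    have m: "card Q = m + 2" "n - 1 = m + 1"
      using False assms(1,3) by (auto simp: m_def)
    obtain a b where \<Sigma>: "\<Sigma> = {a, b}"
      using assms(4) by (auto simp: card_2_iff)
    then have \<Sigma>': "\<Sigma> = {b, a}" by auto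
    show ?thesis
      using small_images_exist[OF \<Sigma>] reset_word_if_small_images[OF \<Sigma> m(1)]
        reset_word_if_small_images[OF \<Sigma>' m(1)] m
      by auto
  qed
  then show ?thesis
    unfolding reset_threshold_def by (rule Least_le)
qed

end
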